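(* Let $0<q<1$, let $\alpha\in\mathbb{R}$ and let $u,v>0$ be such that the $q$-integral defining $(N_q t^{\alpha})(u;v)$ exists. Then $$\left(N_q t^{\alpha}\right)(u;v)=\frac{u^{\alpha}}{v^{\alpha+1}}\,\Gamma_q(\alpha+1).$$
   Context: Fix $0<q<1$. Write $[n]_q=\frac{1-q^n}{1-q}$, $[n]_q!=[n]_q[n-1]_q\cdots[1]_q$, $[0]_q!=1$, and $E_q(x)=\sum_{n=0}^{\infty}q^{n(n-1)/2}\frac{x^n}{[n]_q!}$ (an entire function). The Jackson $q$-integrals are $\int_0^{x}f(t)\,d_qt=(1-q)x\sum_{k=0}^{\infty}q^kf(xq^k)$ and $\int_0^{\infty}f(t)\,d_qt=(1-q)\sum_{k\in\mathbb{Z}}q^kf(q^k)$, provided the sums converge absolutely. The $q$-gamma function (first kind) is $\Gamma_q(t)=\int_0^{1/(1-q)}x^{t-1}E_q(-qx)\,d_qx$ for $t>0$. The $q$-Natural transform of first kind of a function $f$ on $(0,\infty)$ is, for $u,v>0$, $$(N_qf)(u;v)=\frac1u\int_0^{\infty}f(t)\,E_q\!\left(-q\frac{v}{u}t\right)d_qt=\frac{1-q}{u}\sum_{k\in\mathbb{Z}}q^kf(q^k)E_q\!\left(-q^{k+1}\frac{v}{u}\right).$$ The $q$-integral is said to exist at $(u;v)$ if this series converges absolutely. $N_q t^{\alpha}$ denotes the transform of $t\mapsto t^{\alpha}$. *)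

theory Defs
  imports "HOL-Analysis.Infinite_Sum"
begin

definition q_nat :: "real \<Rightarrow> nat \<Rightarrow> real" where
  "q_nat q n = (1 - q ^ n) / (1 - q)"

definition q_fact :: "real \<Rightarrow> nat \<Rightarrow> real" where
  "q_fact q n = (\<Prod>k=1..n. q_nat q k)"

definition E_q :: "real \<Rightarrow> real \<Rightarrow> real" where
  "E_q q x = (\<Sum>n. q ^ (n * (n - 1) div 2) * x ^ n / q_fact q n)"

(* Both Jackson integrals require absolute convergence; infsum is unconditional summation,
   which for real terms is the same thing, and is 0 when the sum does not converge. *)

definition jackson_integral :: "real \<Rightarrow> real \<Rightarrow> (real \<Rightarrow> real) \<Rightarrow> real" where
  "jackson_integral q x f = (1 - q) * x * (\<Sum>\<^sub>\<infinity>k::nat. q ^ k * f (x * q ^ k))"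

definition jackson_integrable_inf :: "real \<Rightarrow> (real \<Rightarrow> real) \<Rightarrow> bool" where
  "jackson_integrable_inf q f \<longleftrightarrow>
     (\<lambda>k::int. q powi k * f (q powi k)) abs_summable_on UNIV"

definition jackson_integral_inf :: "real \<Rightarrow> (real \<Rightarrow> real) \<Rightarrow> real" where
  "jackson_integral_inf q f = (1 - q) * (\<Sum>\<^sub>\<infinity>k::int. q powi k * f (q powi k))"

(* Meaningful for t > 0. *)
definition Gamma_q :: "real \<Rightarrow> real \<Rightarrow> real" where
  "Gamma_q q t = jackson_integral q (1 / (1 - q)) (\<lambda>x. x powr (t - 1) * E_q q (- q * x))"

(* f represents a function on the positive reals: only its values at the points
   q powi k enter. *)

definition q_natural_exists :: "real \<Rightarrow> (real \<Rightarrow> real) \<Rightarrow> real \<Rightarrow> real \<Rightarrow> bool" where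
  "q_natural_exists q f u v \<longleftrightarrow>
     jackson_integrable_inf q (\<lambda>t. f t * E_q q (- q * (v / u) * t))"

definition q_natural :: "real \<Rightarrow> (real \<Rightarrow> real) \<Rightarrow> real \<Rightarrow> real \<Rightarrow> real" where
  "q_natural q f u v =
     1 / u * jackson_integral_inf q (\<lambda>t. f t * E_q q (- q * (v / u) * t))"

end

theory Submission imports Defs begin

text \<open>
  The function \<open>E_q q\<close> satisfies \<open>E_q q x = (1 + (1 - q) * x) * E_q q (q * x)\<close>, which makes it the
  infinite product of the factors \<open>1 + (1 - q) * q ^ n * x\<close>; in particular its zeros are exactly the
  points \<open>- 1 / ((1 - q) * q ^ n)\<close>. This decides when the bilateral \<open>q\<close>-integral can exist. Read along
  \<open>t = q powi k\<close> with \<open>k\<close> tending to minus infinity, the functional equation multiplies the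
  integrand by a factor of unbounded size at each step, so the terms cannot tend to zero unless they
  eventually vanish, that is, unless the points \<open>- q * (v / u) * t\<close> hit a zero of \<open>E_q q\<close>
  (lemma \<open>jackson_integrable_imp_lattice\<close>). Hence existence forces \<open>(1 - q) * v / u\<close> to be an integer power
  \<open>q powi m\<close>.

  Once this holds, all points with \<open>k < - m\<close> are zeros of the integrand, and the shift
  \<open>k = n - m\<close> is the substitution \<open>x = (v / u) * t\<close>, which carries the remaining grid points to
  the points \<open>q ^ n / (1 - q)\<close> on which \<open>Gamma_q\<close> is defined. A change of variables by a general real factor
  is not available for Jackson integrals, which see only one geometric grid; it is the lattice
  condition that makes this one legitimate.
\<close>

section \<open>The \<open>q\<close>-exponential function and its zeros\<close>

definition E_q_coeff :: "real \<Rightarrow> nat \<Rightarrow> real" where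
  "E_q_coeff q n = q ^ (n * (n - 1) div 2) / q_fact q n"

lemma E_q_eq_powser: "E_q q x = (\<Sum>n. E_q_coeff q n * x ^ n)"
  unfolding E_q_def E_q_coeff_def by simp

lemma E_q_0: "E_q q 0 = 1"
  unfolding E_q_eq_powser powser_zero by (simp add: E_q_coeff_def q_fact_def)

lemma E_q_coeff_Suc:
  assumes "0 < q" "q < 1"
  shows "E_q_coeff q (Suc n) * (1 - q ^ Suc n) = (1 - q) * q ^ n * E_q_coeff q n"
proof -
  have "Suc n * (Suc n - 1) = n * (n - 1) + 2 * n"
    by (cases n) (simp_all add: algebra_simps)
  then have exponent: "Suc n * (Suc n - 1) div 2 = n * (n - 1) div 2 + n"
    by simp
  have fact: "q_fact q (Suc n) = q_fact q n * ((1 - q ^ Suc n) / (1 - q))"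
    unfolding q_fact_def by (simp add: q_nat_def)
  have "1 - q ^ Suc n \<noteq> 0"
    using assms power_Suc_less_one[of q n] by simp
  then show ?thesis
    unfolding E_q_coeff_def exponent fact using assms
    by (simp del: power_Suc add: power_add)
qed

lemma summable_E_q:
  assumes "0 < q" "q < 1"
  shows "summable (\<lambda>n. E_q_coeff q n * x ^ n)"
proof -
  have "(\<lambda>n. q ^ n * \<bar>x\<bar>) \<longlonglongrightarrow> 0 * \<bar>x\<bar>"
    using assms by (intro tendsto_mult LIMSEQ_power_zero tendsto_const) simp
  then have "eventually (\<lambda>n. q ^ n * \<bar>x\<bar> < 1 / 2) sequentially"
    by (rule order_tendstoD) simp
  then obtain N where N: "\<And>n. n \<ge> N \<Longrightarrow> q ^ n * \<bar>x\<bar> < 1 / 2"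
    unfolding eventually_sequentially by blast
  have coeff_le: "\<bar>E_q_coeff q (Suc n)\<bar> \<le> q ^ n * \<bar>E_q_coeff q n\<bar>" for n
  proof -
    have le: "1 - q \<le> 1 - q ^ Suc n"
      using assms power_le_one[of q n] by (simp add: mult_left_le)
    have "\<bar>E_q_coeff q (Suc n)\<bar> * (1 - q) \<le> \<bar>E_q_coeff q (Suc n)\<bar> * (1 - q ^ Suc n)"
      by (rule mult_left_mono[OF le]) simp
    also have "\<dots> = \<bar>E_q_coeff q (Suc n) * (1 - q ^ Suc n)\<bar>"
      unfolding abs_mult using le assms by (simp del: power_Suc)
    also have "\<dots> = (q ^ n * \<bar>E_q_coeff q n\<bar>) * (1 - q)"
      unfolding E_q_coeff_Suc[OF assms] using assms by (simp add: abs_mult)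
    finally show ?thesis
      using assms by simp
  qed
  show ?thesis
  proof (rule summable_ratio_test[of "1 / 2" N])
    fix n assume "n \<ge> N"
    have "norm (E_q_coeff q (Suc n) * x ^ Suc n) = \<bar>E_q_coeff q (Suc n)\<bar> * (\<bar>x\<bar> * \<bar>x ^ n\<bar>)"
      by (simp add: abs_mult)
    also have "\<dots> \<le> (q ^ n * \<bar>E_q_coeff q n\<bar>) * (\<bar>x\<bar> * \<bar>x ^ n\<bar>)"
      by (rule mult_right_mono[OF coeff_le]) simp
    also have "\<dots> = (q ^ n * \<bar>x\<bar>) * norm (E_q_coeff q n * x ^ n)"
      by (simp add: abs_mult)
    also have "\<dots> \<le> 1 / 2 * norm (E_q_coeff q n * x ^ n)"
      using N[OF \<open>n \<ge> N\<close>] by (intro mult_right_mono) simp_all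
    finally show "norm (E_q_coeff q (Suc n) * x ^ Suc n) \<le> 1 / 2 * norm (E_q_coeff q n * x ^ n)" .
  qed simp
qed

text \<open>
  In \<open>E_q q x - E_q q (q * x)\<close> the coefficients acquire the factor \<open>1 - q ^ n\<close>, which kills the
  constant term and cancels the last factor of the \<open>q\<close>-factorial in the others; what remains is
  the series of \<open>E_q q (q * x)\<close>, shifted by one place.
\<close>

lemma E_q_rec:
  assumes "0 < q" "q < 1"
  shows "E_q q x = (1 + (1 - q) * x) * E_q q (q * x)"
proof -
  let ?d = "\<lambda>n. E_q_coeff q n * x ^ n - E_q_coeff q n * (q * x) ^ n"
  have summable_d: "summable ?d"
    by (intro summable_diff summable_E_q assms)
  have "E_q q x - E_q q (q * x) = suminf ?d"
    unfolding E_q_eq_powser by (intro suminf_diff summable_E_q assms)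
  also have "\<dots> = (\<Sum>n. ?d (Suc n))"
    using suminf_split_head[OF summable_d] by simp
  also have "\<dots> = (\<Sum>n. (1 - q) * x * (E_q_coeff q n * (q * x) ^ n))"
  proof (rule suminf_cong)
    fix n
    have "?d (Suc n) = (E_q_coeff q (Suc n) * (1 - q ^ Suc n)) * x ^ Suc n"
      by (simp add: algebra_simps power_mult_distrib)
    also have "\<dots> = (1 - q) * x * (E_q_coeff q n * (q * x) ^ n)"
      unfolding E_q_coeff_Suc[OF assms] by (simp add: power_mult_distrib)
    finally show "?d (Suc n) = (1 - q) * x * (E_q_coeff q n * (q * x) ^ n)" .
  qed
  also have "\<dots> = (1 - q) * x * E_q q (q * x)"
    unfolding E_q_eq_powser by (intro suminf_mult summable_E_q assms)
  finally show ?thesis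
    by (simp add: algebra_simps)
qed

lemma E_q_eq_0:
  assumes "0 < q" "q < 1" and "(1 - q) * q ^ n * x = - 1"
  shows "E_q q x = 0"
  using assms(3)
proof (induction n arbitrary: x)
  case 0
  then show ?case
    using E_q_rec[OF assms(1,2), of x] by simp
next
  case (Suc n)
  then have "E_q q (q * x) = 0"
    by (intro Suc.IH) (simp add: mult_ac)
  then show ?case
    using E_q_rec[OF assms(1,2), of x] by simp
qed

lemma isCont_E_q:
  assumes "0 < q" "q < 1"
  shows "isCont (E_q q) x"
proof -
  have "isCont (\<lambda>x. \<Sum>n. E_q_coeff q n * x ^ n) x"
    by (rule isCont_powser[where K = "\<bar>x\<bar> + 1"]) (use summable_E_q[OF assms] in auto)
  then show ?thesis
    unfolding E_q_eq_powser[abs_def] .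
qed

text \<open>
  A zero that no factor of the product accounts for would propagate to all the points
  \<open>q ^ n * x\<close>, which accumulate at \<open>0\<close>, where the value is \<open>1\<close>.
\<close>

lemma E_q_neq_0:
  assumes "0 < q" "q < 1" and factors: "\<And>n. (1 - q) * q ^ n * x \<noteq> - 1"
  shows "E_q q x \<noteq> 0"
proof
  assume zero: "E_q q x = 0"
  have "E_q q (q ^ n * x) = 0" for n
  proof (induction n)
    case (Suc n)
    have "1 + (1 - q) * (q ^ n * x) \<noteq> 0"
      using factors[of n] by (metis add_eq_0_iff mult.assoc)
    then show ?case
      using E_q_rec[OF assms(1,2), of "q ^ n * x"] Suc by (simp add: mult.assoc)
  qed (simp add: zero)
  moreover have "(\<lambda>n. E_q q (q ^ n * x)) \<longlonglongrightarrow> E_q q (0 * x)"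
    using assms(1,2)
    by (intro isCont_tendsto_compose[OF isCont_E_q] tendsto_mult LIMSEQ_power_zero tendsto_const)
      simp_all
  ultimately show False
    by (simp add: E_q_0 LIMSEQ_const_iff)
qed

section \<open>Existence of the transform confines \<open>v / u\<close> to a lattice\<close>

text \<open>
  Along \<open>t = r ^ n\<close> with \<open>r = 1 / q\<close> the terms \<open>a n\<close> of the series satisfy
  \<open>a (Suc n) = r powr (\<alpha> + 1) * (1 - (1 - q) * c * r ^ n) * a n\<close>. The multiplier is eventually
  larger than \<open>1\<close> in absolute value, so nonzero terms would stay bounded away from \<open>0\<close>. Off the
  lattice no \<open>- q * c * r ^ n\<close> is a zero of \<open>E_q q\<close>, so all terms are nonzero.
\<close>

lemma jackson_integrable_imp_lattice:
  fixes q c \<alpha> :: real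
  assumes q: "0 < q" "q < 1" and "c > 0"
    and ex: "jackson_integrable_inf q (\<lambda>t. t powr \<alpha> * E_q q (- q * c * t))"
  shows "\<exists>m::int. (1 - q) * c = q powi m"
proof (rule ccontr)
  assume off_lattice: "\<nexists>m::int. (1 - q) * c = q powi m"
  define r where "r = 1 / q"
  have r: "r > 1" "q * r = 1"
    using q by (auto simp: r_def)
  define a where "a n = r ^ n * ((r ^ n) powr \<alpha> * E_q q (- q * c * r ^ n))" for n
  have r_power: "r ^ n = q powi (- int n)" for n
    by (simp add: r_def power_int_minus power_one_over field_simps)

  have a_nonzero: "a n \<noteq> 0" for n
  proof -
    have "E_q q (- q * c * r ^ n) \<noteq> 0"
    proof (rule E_q_neq_0[OF q])
      fix j
      show "(1 - q) * q ^ j * (- q * c * r ^ n) \<noteq> - 1"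
      proof
        assume "(1 - q) * q ^ j * (- q * c * r ^ n) = - 1"
        then have "((1 - q) * c) * (q ^ Suc j * r ^ n) = 1"
          by (simp add: mult_ac)
        then have "(1 - q) * c = q ^ n / q ^ Suc j"
          using q by (simp add: r_def field_simps)
        also have "\<dots> = q powi (int n - int (Suc j))"
          using q by (subst power_int_diff) (simp_all del: power_Suc of_nat_Suc)
        finally show False
          using off_lattice by blast
      qed
    qed
    then show ?thesis
      using r by (simp add: a_def)
  qed

  have a_Suc: "a (Suc n) = r powr (\<alpha> + 1) * (1 - (1 - q) * c * r ^ n) * a n" for n
  proof -
    have "- q * c * r ^ Suc n = - (c * r ^ n)"
      using r(2) by (simp add: mult_ac)
    then have E: "E_q q (- q * c * r ^ Suc n) = (1 - (1 - q) * c * r ^ n) * E_q q (- q * c * r ^ n)"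
      using E_q_rec[OF q, of "- (c * r ^ n)"] by (simp only: minus_mult_commute mult.assoc) simp
    have powers: "r ^ Suc n * (r ^ Suc n) powr \<alpha> = r powr (\<alpha> + 1) * (r ^ n * (r ^ n) powr \<alpha>)"
      using r by (simp add: powr_mult powr_add mult_ac)
    have "a (Suc n) = (r ^ Suc n * (r ^ Suc n) powr \<alpha>) * E_q q (- q * c * r ^ Suc n)"
      unfolding a_def by (rule mult.assoc[symmetric])
    also have "\<dots> = r powr (\<alpha> + 1) * (1 - (1 - q) * c * r ^ n) * a n"
      unfolding powers E a_def by (simp only: mult_ac)
    finally show ?thesis .
  qed

  have "a \<longlonglongrightarrow> 0"
  proof -
    let ?f = "\<lambda>k::int. q powi k * ((q powi k) powr \<alpha> * E_q q (- q * c * (q powi k)))"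
    have "?f abs_summable_on UNIV"
      using ex by (simp add: jackson_integrable_inf_def)
    then have "?f abs_summable_on range (\<lambda>n::nat. - int n)"
      by (rule summable_on_subset_banach) simp
    then have "(?f \<circ> (\<lambda>n::nat. - int n)) abs_summable_on UNIV"
      by (subst (asm) summable_on_reindex) (auto simp: inj_on_def o_def)
    then have "(\<lambda>n. norm (a n)) summable_on UNIV"
      by (simp add: o_def a_def r_power)
    then have "summable (\<lambda>n. norm (a n))"
      by (rule summable_on_imp_summable)
    then show ?thesis
      by (rule summable_LIMSEQ_zero[OF summable_norm_cancel])
  qed

  \<comment> \<open>From this \<open>N\<close> on, the multiplier in \<open>a_Suc\<close> has absolute value at least \<open>1\<close>.\<close>
  obtain N where "(1 + r powr (- (\<alpha> + 1))) / ((1 - q) * c) < r ^ N"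
    using real_arch_pow[OF r(1)] by blast
  then have large_at_N: "1 + r powr (- (\<alpha> + 1)) \<le> (1 - q) * c * r ^ N"
    using q \<open>c > 0\<close> by (simp add: field_simps)
  have N: "1 + r powr (- (\<alpha> + 1)) \<le> (1 - q) * c * r ^ n" if "n \<ge> N" for n
  proof -
    have "(1 - q) * c * r ^ N \<le> (1 - q) * c * r ^ n"
      using that r q \<open>c > 0\<close> by (intro mult_left_mono power_increasing) simp_all
    then show ?thesis
      using large_at_N by linarith
  qed
  have mono: "\<bar>a n\<bar> \<le> \<bar>a (Suc n)\<bar>" if "n \<ge> N" for n
  proof -
    have "1 = r powr (\<alpha> + 1) * r powr (- (\<alpha> + 1))"
      using r by (simp flip: powr_add)
    also have "\<dots> \<le> r powr (\<alpha> + 1) * \<bar>1 - (1 - q) * c * r ^ n\<bar>"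
      using N[OF that] by (intro mult_left_mono) simp_all
    finally have "1 * \<bar>a n\<bar> \<le> (r powr (\<alpha> + 1) * \<bar>1 - (1 - q) * c * r ^ n\<bar>) * \<bar>a n\<bar>"
      by (rule mult_right_mono) simp
    then show ?thesis
      unfolding a_Suc by (simp add: abs_mult)
  qed
  have "\<bar>a N\<bar> \<le> \<bar>a n\<bar>" if "n \<ge> N" for n
    using that by (induction rule: dec_induct) (use mono order_trans in auto)
  moreover have "(\<lambda>n. \<bar>a n\<bar>) \<longlonglongrightarrow> 0"
    using \<open>a \<longlonglongrightarrow> 0\<close> by (rule tendsto_rabs_zero)
  ultimately have "\<bar>a N\<bar> \<le> 0"
    by (intro LIMSEQ_le_const) auto
  then show False
    using a_nonzero[of N] by simp
qed

section \<open>The transform of a power\<close>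

theorem theorem1:
  fixes q \<alpha> u v :: real
  assumes "0 < q" and "q < 1"
    and "u > 0" and "v > 0"
    and "q_natural_exists q (\<lambda>t. t powr \<alpha>) u v"
  shows "q_natural q (\<lambda>t. t powr \<alpha>) u v = u powr \<alpha> / v powr (\<alpha> + 1) * Gamma_q q (\<alpha> + 1)"
proof -
  note q = assms(1,2)
  obtain m :: int where m: "(1 - q) * (v / u) = q powi m"
    using jackson_integrable_imp_lattice[OF q, of "v / u" \<alpha>] assms by (auto simp: q_natural_exists_def)
  define w where "w = u / v * (1 / (1 - q))"
  have "w = 1 / q powi m"
    unfolding m[symmetric] w_def using assms by (simp add: field_simps)
  then have grid: "q powi (int n - m) = w * q ^ n" for n
    using q by (simp add: power_int_diff)
  define f where "f k = q powi k * ((q powi k) powr \<alpha> * E_q q (- q * (v / u) * (q powi k)))" for k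
  define g where "g n = q ^ n * ((1 / (1 - q) * q ^ n) powr \<alpha> * E_q q (- q * (1 / (1 - q) * q ^ n)))"
    for n :: nat

  \<comment> \<open>Here the factor with index \<open>j = - m - k - 1\<close> in the product for \<open>E_q q\<close> vanishes.\<close>
  have f_eq_0: "f k = 0" if "k < - m" for k
  proof -
    define j where "j = nat (- m - k - 1)"
    have "(1 - q) * q ^ j * (- q * (v / u) * q powi k) = - (((1 - q) * (v / u)) * (q ^ Suc j * q powi k))"
      by (simp add: mult_ac)
    also have "\<dots> = - (q powi (m + (int (Suc j) + k)))"
      unfolding m using q by (simp add: power_int_add)
    also have "m + (int (Suc j) + k) = 0"
      using that by (simp add: j_def)
    finally have "E_q q (- q * (v / u) * q powi k) = 0"
      by (intro E_q_eq_0[OF q, of j]) (simp only: power_int_0_right)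
    then show ?thesis
      by (simp add: f_def)
  qed

  have f_shift: "f (int n - m) = w * (u / v) powr \<alpha> * g n" for n
  proof -
    have argument: "- q * (v / u) * (w * q ^ n) = - q * (1 / (1 - q) * q ^ n)"
      using assms by (simp add: w_def)
    have power: "(w * q ^ n) powr \<alpha> = (u / v) powr \<alpha> * (1 / (1 - q) * q ^ n) powr \<alpha>"
      unfolding w_def mult.assoc by (rule powr_mult)
    show ?thesis
      unfolding f_def g_def grid argument power by (simp only: mult_ac)
  qed

  have "(\<Sum>\<^sub>\<infinity>k. f k) = (\<Sum>\<^sub>\<infinity>k\<in>range (\<lambda>n::nat. int n - m). f k)"
  proof (rule infsum_cong_neutral)
    fix k assume "k \<in> UNIV - range (\<lambda>n::nat. int n - m)"
    then have "k \<noteq> int (nat (k + m)) - m"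
      by blast
    then show "f k = 0"
      by (intro f_eq_0) (simp split: if_splits)
  qed simp_all
  also have "\<dots> = (\<Sum>\<^sub>\<infinity>n. f (int n - m))"
    by (subst infsum_reindex) (simp_all add: inj_on_def o_def)
  also have "\<dots> = w * (u / v) powr \<alpha> * (\<Sum>\<^sub>\<infinity>n. g n)"
    unfolding f_shift by (rule infsum_cmult_right')
  also have "(\<Sum>\<^sub>\<infinity>n. g n) = Gamma_q q (\<alpha> + 1)"
    using q by (simp add: Gamma_q_def jackson_integral_def g_def)
  finally have "q_natural q (\<lambda>t. t powr \<alpha>) u v
      = 1 / u * ((1 - q) * (w * (u / v) powr \<alpha> * Gamma_q q (\<alpha> + 1)))"
    by (simp add: q_natural_def jackson_integral_inf_def f_def)
  also have "\<dots> = u powr \<alpha> / v powr (\<alpha> + 1) * Gamma_q q (\<alpha> + 1)"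
    using assms by (simp add: w_def powr_divide powr_add)
  finally show ?thesis .
qed

end
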